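(* Let $\Gamma$ be a cellularly embedded graph (ceg) with $n$ vertices and no isolated vertices. Then $\Gamma$ comes from a factorization, i.e. $\Gamma$ is isomorphic to the closure $\overline{P(\Gamma')}$ of the properly embedded graph $P(\Gamma')$ of some e-graph $\Gamma'$, if and only if the medial digraph of $\Gamma$ has a feedback arc set of cardinality $n$.
   Context: Graphs $\Gamma$ are finite and loopless (multiple edges allowed); digraphs may have loops and multiple arcs. A ceg is a graph embedded in a closed oriented surface such that each component of the complement is an open disc. Isomorphism of cegs: orientation-preserving homeomorphism of the surfaces restricting to a graph isomorphism. A ceg is determined by its rotation system: the cyclic (counterclockwise) orders of the edges around each vertex. Medial digraph of a ceg: the vertices are the edges of $\Gamma$, and for each vertex $v$ of $\Gamma$ and each edge $e$ at $v$ there is one arc from $e$ to the edge following $e$ in the rotation at $v$ (a loop if $v$ has degree $1$). A feedback arc set in a digraph is a set of arcs whose removal leaves a digraph without directed cycles (a dag). An e-graph of size $m$ is a graph with $m$ edges labeled bijectively by $[m]$ (equivalently, up to naming the vertices, a factorization, i.e. a sequence of $m$ transpositions, the $i$-th one interchanging the endpoints of the edge labeled $i$). The surface of $P(\Gamma')$ is constructed as follows: for each vertex $v$ with incident edges $e_1<\dots<e_d$ (ordered by label) take an oriented disc thickening the star of $v$, modeled on a neighborhood in the closed upper half plane with $v$ at the origin on the boundary line, the half-edges drawn from $v$ into the upper half plane with $e_1,\dots,e_d$ in counterclockwise order starting from the right, each half-edge thickened to a ribbon with a free end; then, for each edge, glue the free ends of the ribbons of its two half-edges by an orientation-reversing homeomorphism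 of intervals (matching the half-edges). This gives a compact oriented surface $F$ with boundary, with $\Gamma'$ embedded in it and all vertices on $\partial F$. The closure $\overline{P(\Gamma')}$ is the ceg obtained by attaching a disc along each boundary component of $F$; its rotation system is obtained by completing the linear order of the edges at each vertex to a cyclic order. *)

theory Defs
  imports "Graph_Theory.Arc_Walk" "HOL-Combinatorics.Orbits"
begin

section \<open>Finite loopless graphs with multiple edges\<close>

record ('v, 'e) mgraph =
  vertices :: "'v set"
  edges :: "'e set"
  ends :: "'e \<Rightarrow> 'v set"

definition is_mgraph :: "('v, 'e, 'z) mgraph_scheme \<Rightarrow> bool" where
  "is_mgraph \<Gamma> \<longleftrightarrow> finite (vertices \<Gamma>) \<and> finite (edges \<Gamma>) \<and>
     (\<forall>e\<in>edges \<Gamma>. ends \<Gamma> e \<subseteq> vertices \<Gamma> \<and> card (ends \<Gamma> e) = 2)"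

definition edges_at :: "('v, 'e, 'z) mgraph_scheme \<Rightarrow> 'v \<Rightarrow> 'e set" where
  "edges_at \<Gamma> v = {e \<in> edges \<Gamma>. v \<in> ends \<Gamma> e}"

definition no_isolated_vertices :: "('v, 'e, 'z) mgraph_scheme \<Rightarrow> bool" where
  "no_isolated_vertices \<Gamma> \<longleftrightarrow> (\<forall>v\<in>vertices \<Gamma>. edges_at \<Gamma> v \<noteq> {})"

section \<open>Cellularly embedded graphs\<close>

text \<open>
  A graph cellularly embedded in a closed oriented surface is represented by its rotation system:
  \<open>rot \<Gamma> v e\<close> is the edge following \<open>e\<close> counterclockwise around \<open>v\<close>.  As graphs are
  loopless, an edge has at most one half-edge at \<open>v\<close>, so a cyclic order of the half-edges at \<open>v\<close>
  is a cyclic order of \<open>edges_at \<Gamma> v\<close>.  Neither the graph nor the surface need be connected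
  (there is one component of the surface for each component of the graph).  The values of
  \<open>rot \<Gamma> v\<close> outside \<open>edges_at \<Gamma> v\<close> are irrelevant.
\<close>

record ('v, 'e) ceg = "('v, 'e) mgraph" +
  rot :: "'v \<Rightarrow> 'e \<Rightarrow> 'e"

definition is_ceg :: "('v, 'e) ceg \<Rightarrow> bool" where
  "is_ceg \<Gamma> \<longleftrightarrow> is_mgraph \<Gamma> \<and>
     (\<forall>v\<in>vertices \<Gamma>. edges_at \<Gamma> v \<noteq> {} \<longrightarrow> cyclic_on (rot \<Gamma> v) (edges_at \<Gamma> v))"

text \<open>
  An orientation-preserving homeomorphism carries the counterclockwise rotation at \<open>v\<close> to the
  counterclockwise rotation at the image of \<open>v\<close>, and every graph isomorphism doing so extends to
  such a homeomorphism.
\<close>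

definition ceg_iso :: "('v, 'e) ceg \<Rightarrow> ('w, 'f) ceg \<Rightarrow> bool" where
  "ceg_iso \<Gamma> \<Delta> \<longleftrightarrow> (\<exists>\<phi> \<psi>.
     bij_betw \<phi> (vertices \<Gamma>) (vertices \<Delta>) \<and>
     bij_betw \<psi> (edges \<Gamma>) (edges \<Delta>) \<and>
     (\<forall>e\<in>edges \<Gamma>. ends \<Delta> (\<psi> e) = \<phi> ` ends \<Gamma> e) \<and>
     (\<forall>v\<in>vertices \<Gamma>. \<forall>e\<in>edges_at \<Gamma> v. rot \<Delta> (\<phi> v) (\<psi> e) = \<psi> (rot \<Gamma> v e)))"

section \<open>Medial digraphs and feedback arc sets\<close>

text \<open>The arc \<open>(v, e)\<close> is the one contributed by the vertex \<open>v\<close> and the edge \<open>e\<close> at \<open>v\<close>.\<close>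

definition medial_digraph :: "('v, 'e) ceg \<Rightarrow> ('e, 'v \<times> 'e) pre_digraph" where
  "medial_digraph \<Gamma> = \<lparr>
     verts = edges \<Gamma>,
     arcs = {(v, e). v \<in> vertices \<Gamma> \<and> e \<in> edges_at \<Gamma> v},
     tail = (\<lambda>(v, e). e),
     head = (\<lambda>(v, e). rot \<Gamma> v e) \<rparr>"

definition is_dag :: "('a, 'b) pre_digraph \<Rightarrow> bool" where
  "is_dag G \<longleftrightarrow> (\<nexists>p. pre_digraph.cycle G p)"

definition feedback_arc_set :: "('a, 'b) pre_digraph \<Rightarrow> 'b set \<Rightarrow> bool" where
  "feedback_arc_set G F \<longleftrightarrow> F \<subseteq> arcs G \<and> is_dag (G\<lparr>arcs := arcs G - F\<rparr>)"

section \<open>Edge-labeled graphs and their properly embedded graphs\<close>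

record ('v, 'e) egraph = "('v, 'e) mgraph" +
  label :: "'e \<Rightarrow> nat"

definition is_egraph :: "nat \<Rightarrow> ('v, 'e) egraph \<Rightarrow> bool" where
  "is_egraph m \<Gamma> \<longleftrightarrow> is_mgraph \<Gamma> \<and> bij_betw (label \<Gamma>) (edges \<Gamma>) {1..m}"

text \<open>
  A graph properly embedded in a compact oriented surface with boundary, with all its vertices on
  the boundary, obtained by gluing ribbons to half-discs at the vertices, is represented by
  the linear order, counterclockwise from the boundary on the right to the boundary on the left,
  of the edges at each vertex:
  \<open>(e, f) \<in> lin \<Gamma> v\<close> means that \<open>e\<close> comes strictly before \<open>f\<close> at \<open>v\<close>.
\<close>

record ('v, 'e) peg = "('v, 'e) mgraph" +
  lin :: "'v \<Rightarrow> ('e \<times> 'e) set"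

definition is_peg :: "('v, 'e) peg \<Rightarrow> bool" where
  "is_peg \<Gamma> \<longleftrightarrow> is_mgraph \<Gamma> \<and>
     (\<forall>v\<in>vertices \<Gamma>. lin \<Gamma> v \<subseteq> edges_at \<Gamma> v \<times> edges_at \<Gamma> v \<and>
        strict_linear_order_on (edges_at \<Gamma> v) (lin \<Gamma> v))"

definition peg_of_egraph :: "('v, 'e) egraph \<Rightarrow> ('v, 'e) peg" where
  "peg_of_egraph \<Gamma> = \<lparr>
     vertices = vertices \<Gamma>,
     edges = edges \<Gamma>,
     ends = ends \<Gamma>,
     lin = (\<lambda>v. {(e, f). e \<in> edges_at \<Gamma> v \<and> f \<in> edges_at \<Gamma> v \<and> label \<Gamma> e < label \<Gamma> f}) \<rparr>"

text \<open>
  The successor of \<open>e\<close> in the cyclic completion of the strict linear order \<open>r\<close> on the finite set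
  \<open>A\<close>: the least element above \<open>e\<close>, or the least element of \<open>A\<close> if \<open>e\<close> is the greatest one.
\<close>

definition least_of :: "('e \<times> 'e) set \<Rightarrow> 'e set \<Rightarrow> 'e" where
  "least_of r B = (THE f. f \<in> B \<and> (\<forall>g\<in>B. g \<noteq> f \<longrightarrow> (f, g) \<in> r))"

definition cyclic_succ :: "'e set \<Rightarrow> ('e \<times> 'e) set \<Rightarrow> 'e \<Rightarrow> 'e" where
  "cyclic_succ A r e =
     (if \<exists>f\<in>A. (e, f) \<in> r then least_of r {f \<in> A. (e, f) \<in> r} else least_of r A)"

text \<open>
  Attaching discs along the boundary components places the two ends of the half-disc
  boundary at \<open>v\<close> next to each other, so that the first edge at \<open>v\<close> follows the last one.
\<close>

definition peg_closure :: "('v, 'e) peg \<Rightarrow> ('v, 'e) ceg" where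
  "peg_closure \<Gamma> = \<lparr>
     vertices = vertices \<Gamma>,
     edges = edges \<Gamma>,
     ends = ends \<Gamma>,
     rot = (\<lambda>v. cyclic_succ (edges_at \<Gamma> v) (lin \<Gamma> v)) \<rparr>"

text \<open>
  The e-graph may be taken with vertices and edges of the same types as those of \<open>\<Gamma>\<close>: an e-graph
  over any other types whose closure is isomorphic to \<open>\<Gamma>\<close> has as many vertices and
  edges as \<open>\<Gamma>\<close> and can be renamed.
\<close>

definition comes_from_factorization :: "('v, 'e) ceg \<Rightarrow> bool" where
  "comes_from_factorization \<Gamma> \<longleftrightarrow>
     (\<exists>m (\<Gamma>' :: ('v, 'e) egraph). is_egraph m \<Gamma>' \<and>
        ceg_iso \<Gamma> (peg_closure (peg_of_egraph \<Gamma>')))"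

section \<open>Well-formedness of the constructions\<close>

lemma is_peg_peg_of_egraph:
  assumes "is_egraph m \<Gamma>"
  shows "is_peg (peg_of_egraph \<Gamma>)"
proof -
  have inj: "inj_on (label \<Gamma>) (edges \<Gamma>)"
    using assms by (auto simp: is_egraph_def bij_betw_def)
  have eq: "edges_at (peg_of_egraph \<Gamma>) v = edges_at \<Gamma> v" for v
    by (simp add: edges_at_def peg_of_egraph_def)
  show ?thesis
    using assms inj unfolding is_peg_def eq
    by (auto simp: is_egraph_def is_mgraph_def peg_of_egraph_def strict_linear_order_on_def
        trans_def irrefl_def total_on_def edges_at_def inj_on_def) (meson linorder_neqE_nat)+
qed

lemma least_of_eqI:
  assumes "trans r" "irrefl r" "f \<in> B" "\<And>g. g \<in> B \<Longrightarrow> g \<noteq> f \<Longrightarrow> (f, g) \<in> r"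
  shows "least_of r B = f"
  unfolding least_of_def
proof (rule the_equality)
  fix g assume g: "g \<in> B \<and> (\<forall>h\<in>B. h \<noteq> g \<longrightarrow> (g, h) \<in> r)"
  show "g = f"
    using assms g by (metis irrefl_def transD)
qed (use assms in auto)

lemma exists_least:
  assumes "strict_linear_order_on A r" "finite B" "B \<subseteq> A" "B \<noteq> {}"
  shows "\<exists>f\<in>B. \<forall>g\<in>B. g \<noteq> f \<longrightarrow> (f, g) \<in> r"
  using assms(2,4,3)
proof (induction B rule: finite_ne_induct)
  case (singleton x)
  then show ?case by simp
next
  case (insert x F)
  then obtain f where f: "f \<in> F" "\<forall>g\<in>F. g \<noteq> f \<longrightarrow> (f, g) \<in> r" by auto
  have tr: "trans r" and "(x, f) \<in> r \<or> (f, x) \<in> r"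
    using assms(1) insert f by (auto simp: strict_linear_order_on_def total_on_def)
  then show ?case
    using f by (metis insert_iff transD)
qed

lemma exists_greatest:
  assumes "strict_linear_order_on A r" "finite B" "B \<subseteq> A" "B \<noteq> {}"
  shows "\<exists>f\<in>B. \<forall>g\<in>B. g \<noteq> f \<longrightarrow> (g, f) \<in> r"
  using exists_least[of A "r\<inverse>" B] assms
  by (auto simp: strict_linear_order_on_def irrefl_def total_on_def)

lemma cyclic_on_cyclic_succ:
  assumes lin: "strict_linear_order_on A r" and fin: "finite A" and ne: "A \<noteq> {}"
  shows "cyclic_on (cyclic_succ A r) A"
proof -
  let ?s = "cyclic_succ A r"
  have r: "trans r" "irrefl r" and tot: "total_on A r"
    using lin by (auto simp: strict_linear_order_on_def)
  obtain m where m: "m \<in> A" "\<And>g. g \<in> A \<Longrightarrow> g \<noteq> m \<Longrightarrow> (m, g) \<in> r"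
    using exists_least[OF lin fin subset_refl ne] by blast
  obtain M where M: "M \<in> A" "\<And>g. g \<in> A \<Longrightarrow> g \<noteq> M \<Longrightarrow> (g, M) \<in> r"
    using exists_greatest[OF lin fin subset_refl ne] by blast
  have "\<not> (\<exists>f\<in>A. (M, f) \<in> r)"
    using M r by (metis irrefl_def transD)
  then have sM: "?s M = m"
    using least_of_eqI[OF r, of m A] m by (simp add: cyclic_succ_def)
  have closed: "?s e \<in> A" if "e \<in> A" for e
  proof (cases "\<exists>f\<in>A. (e, f) \<in> r")
    case True
    then have "{f \<in> A. (e, f) \<in> r} \<noteq> {}" by auto
    then obtain f where "f \<in> A" "(e, f) \<in> r" "\<forall>g\<in>{f \<in> A. (e, f) \<in> r}. g \<noteq> f \<longrightarrow> (f, g) \<in> r"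
      using exists_least[OF lin, of "{f \<in> A. (e, f) \<in> r}"] fin by auto
    then have "?s e = f"
      using True least_of_eqI[OF r, of f "{f \<in> A. (e, f) \<in> r}"] by (simp add: cyclic_succ_def)
    then show ?thesis using \<open>f \<in> A\<close> by simp
  next
    case False
    then show ?thesis
      using least_of_eqI[OF r, of m A] m by (simp add: cyclic_succ_def)
  qed
  have pred: "\<exists>p\<in>A. (p, e) \<in> r \<and> ?s p = e" if e: "e \<in> A" "e \<noteq> m" for e
  proof -
    have "{p \<in> A. (p, e) \<in> r} \<noteq> {}" using m e by auto
    then obtain p where p: "p \<in> A" "(p, e) \<in> r" "\<forall>g\<in>{p \<in> A. (p, e) \<in> r}. g \<noteq> p \<longrightarrow> (g, p) \<in> r"
      using exists_greatest[OF lin, of "{p \<in> A. (p, e) \<in> r}"] fin by auto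
    have "(e, g) \<in> r" if "g \<in> A" "(p, g) \<in> r" "g \<noteq> e" for g
      using that p e r tot by (metis (mono_tags, lifting) irrefl_def mem_Collect_eq total_on_def transD)
    then have "?s p = e"
      using p e least_of_eqI[OF r, of e "{f \<in> A. (p, f) \<in> r}"] by (auto simp: cyclic_succ_def)
    then show ?thesis using p by auto
  qed
  have from_m: "e = m \<or> e \<in> orbit ?s m" if "e \<in> A" for e
    using that
  proof (induction "card {p \<in> A. (p, e) \<in> r}" arbitrary: e rule: less_induct)
    case less
    show ?case
    proof (cases "e = m")
      case False
      then obtain p where p: "p \<in> A" "(p, e) \<in> r" "?s p = e"
        using pred less.prems by blast
      have "{q \<in> A. (q, p) \<in> r} \<subset> {q \<in> A. (q, e) \<in> r}"
      proof
        show "{q \<in> A. (q, p) \<in> r} \<subseteq> {q \<in> A. (q, e) \<in> r}"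
          using p r by (auto dest: transD)
        have "p \<in> {q \<in> A. (q, e) \<in> r}" "p \<notin> {q \<in> A. (q, p) \<in> r}"
          using p r by (auto simp: irrefl_def)
        then show "{q \<in> A. (q, p) \<in> r} \<noteq> {q \<in> A. (q, e) \<in> r}" by blast
      qed
      then have "p = m \<or> p \<in> orbit ?s m"
        using less.hyps p fin by (simp add: psubset_card_mono)
      then show ?thesis
        using p by (metis orbit.base orbit.step)
    qed simp
  qed
  have "m \<in> orbit ?s m"
    using from_m[OF M(1)] sM by (metis orbit.base orbit.step)
  then have "A \<subseteq> orbit ?s m"
    using from_m by auto
  moreover have "e \<in> A" if "e \<in> orbit ?s m" for e
    using that by (induction rule: orbit.induct) (use m closed in auto)
  ultimately show ?thesis
    using m by (auto simp: cyclic_on_def)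
qed

lemma is_ceg_peg_closure:
  assumes "is_peg \<Gamma>"
  shows "is_ceg (peg_closure \<Gamma>)"
proof -
  have eq: "edges_at (peg_closure \<Gamma>) v = edges_at \<Gamma> v" for v
    by (simp add: edges_at_def peg_closure_def)
  have "finite (edges_at \<Gamma> v)" for v
    using assms by (simp add: is_peg_def is_mgraph_def edges_at_def)
  then have "cyclic_on (rot (peg_closure \<Gamma>) v) (edges_at \<Gamma> v)"
    if "v \<in> vertices \<Gamma>" "edges_at \<Gamma> v \<noteq> {}" for v
    using that assms by (simp add: is_peg_def peg_closure_def cyclic_on_cyclic_succ)
  then show ?thesis
    using assms unfolding is_ceg_def eq
    by (simp add: is_peg_def is_mgraph_def peg_closure_def)
qed

lemma fin_digraph_medial_digraph:
  assumes "is_ceg \<Gamma>"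
  shows "fin_digraph (medial_digraph \<Gamma>)"
proof
  have rot: "rot \<Gamma> v e \<in> edges_at \<Gamma> v" if "v \<in> vertices \<Gamma>" "e \<in> edges_at \<Gamma> v" for v e
    using that assms by (auto simp: is_ceg_def dest!: bspec[where x = v] intro: cyclic_on_inI)
  show "head (medial_digraph \<Gamma>) a \<in> verts (medial_digraph \<Gamma>)" if "a \<in> arcs (medial_digraph \<Gamma>)" for a
    using that rot by (auto simp: medial_digraph_def edges_at_def)
  have "arcs (medial_digraph \<Gamma>) \<subseteq> vertices \<Gamma> \<times> edges \<Gamma>"
    by (auto simp: medial_digraph_def edges_at_def)
  then show "finite (arcs (medial_digraph \<Gamma>))"
    using assms by (metis finite_SigmaI finite_subset is_ceg_def is_mgraph_def)
qed (use assms in \<open>auto simp: medial_digraph_def edges_at_def is_ceg_def is_mgraph_def\<close>)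

end

theory Submission
  imports Defs
begin

text \<open>
  Call an arc of the medial digraph a descent of an edge numbering \<open>l\<close> if \<open>l\<close> does not strictly
  increase along it.  Both sides of the equivalence say that some bijective numbering of the edges
  has exactly one descent at each vertex.

  Topological sorting makes the complement of a set \<open>F\<close> of arcs acyclic exactly when \<open>F\<close> contains
  all descents of some numbering (\<open>feedback_arc_set_iff_contains_descents\<close>).  The arcs contributed
  by one vertex form a closed walk, along which a numbering cannot always increase, so a numbering
  has at least one descent at each vertex (\<open>descents_meet_every_vertex\<close>).  Hence a feedback arc set
  has at least \<open>n\<close> elements, and one of size \<open>n\<close> is the set of descents of a numbering with one
  descent per vertex.

  Completing the increasing order of labels at a vertex to a cyclic order creates one descent, from
  the greatest label to the least.  Conversely, a cyclic order with a single descent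
  runs through the labels in increasing order and then returns to the start, so it is
  that completion (\<open>cyclic_succ_eq_if_single_descent\<close>).  Hence a numbering comes from a
  factorization with closure \<open>\<Gamma>\<close> exactly when it has one descent per vertex
  (\<open>comes_from_factorization_iff_descents\<close>).
\<close>

section \<open>Cyclic orders with a single descent\<close>

lemma cyclic_succ_ascends_iff:
  assumes lin: "strict_linear_order_on A r" and fin: "finite A" and e: "e \<in> A"
  shows "(e, cyclic_succ A r e) \<in> r \<longleftrightarrow> (\<exists>f\<in>A. (e, f) \<in> r)"
proof -
  have r: "trans r" "irrefl r"
    using lin by (auto simp: strict_linear_order_on_def)
  have least_in: "least_of r B \<in> B" if B: "B \<subseteq> A" "B \<noteq> {}" for B
  proof -
    obtain f where f: "f \<in> B" "\<forall>g\<in>B. g \<noteq> f \<longrightarrow> (f, g) \<in> r"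
      using exists_least[OF lin finite_subset[OF B(1) fin] B] by blast
    then have "least_of r B = f"
      using least_of_eqI[OF r] by blast
    with f show ?thesis by simp
  qed
  show ?thesis
    using least_in[of "{f \<in> A. (e, f) \<in> r}"] least_in[of A] e by (auto simp: cyclic_succ_def)
qed

lemma cyclic_on_bij_betw:
  assumes "cyclic_on f A"
  shows "bij_betw f A A"
proof -
  have "A \<subseteq> f ` A"
  proof
    fix x assume "x \<in> A"
    with assms have "x \<in> orbit f x" "A = orbit f x"
      by (auto simp: cyclic_on_alldef)
    then show "x \<in> f ` A"
      using \<open>x \<in> A\<close> by (cases rule: orbit.cases) auto
  qed
  moreover have "f ` A \<subseteq> A"
    using assms by (auto intro: cyclic_on_inI)
  ultimately show ?thesis
    using finite_surj_inj[OF finite_cyclic_on[OF assms]] by (auto simp: bij_betw_def)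
qed

text \<open>
  If some \<open>g\<close> lay strictly between \<open>e\<close> and \<open>f e\<close>, then two different steps of \<open>f\<close>, the one from
  \<open>e\<close> and the one into \<open>g\<close>, would leave the initial segment below \<open>g\<close>.  But only
  the step from \<open>M\<close> can enter that segment, and a permutation enters a finite set as often as it
  leaves it.
\<close>

lemma cyclic_succ_eq_if_single_descent:
  assumes lin: "strict_linear_order_on A r" and cyc: "cyclic_on f A"
    and M: "M \<in> A" and asc: "\<And>x. x \<in> A \<Longrightarrow> x \<noteq> M \<Longrightarrow> (x, f x) \<in> r" and e: "e \<in> A"
  shows "cyclic_succ A r e = f e"
proof -
  have tr: "trans r" and irr: "irrefl r" and tot: "total_on A r"
    using lin by (auto simp: strict_linear_order_on_def)
  have asym: "(y, x) \<notin> r" if "(x, y) \<in> r" for x y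
    using that tr irr by (meson irrefl_def transD)
  have fin: "finite A" and bij: "bij_betw f A A"
    using cyc by (auto intro: finite_cyclic_on cyclic_on_bij_betw)
  have fA: "f x \<in> A" if "x \<in> A" for x
    using cyc that by (rule cyclic_on_inI)
  have ne: "A \<noteq> {}" using M by auto
  have M_greatest: "(g, M) \<in> r" if g: "g \<in> A" "g \<noteq> M" for g
  proof -
    obtain x where x: "x \<in> A" "\<forall>g\<in>A. g \<noteq> x \<longrightarrow> (g, x) \<in> r"
      using exists_greatest[OF lin fin subset_refl ne] by blast
    have "x = M"
      using asc[of x] x fA[of x] asym irr by (metis irrefl_def)
    then show ?thesis using x g by blast
  qed
  have fM_least: "(f M, g) \<in> r" if g: "g \<in> A" "g \<noteq> f M" for g
  proof -
    obtain x where x: "x \<in> A" "\<forall>g\<in>A. g \<noteq> x \<longrightarrow> (x, g) \<in> r"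
      using exists_least[OF lin fin subset_refl ne] by blast
    obtain y where y: "y \<in> A" "x = f y"
      using x bij by (auto simp: bij_betw_def)
    have "y = M"
      using asc[of y] x y asym irr by (metis irrefl_def)
    then show ?thesis using x y g by blast
  qed
  show ?thesis
  proof (cases "e = M")
    case True
    then have "\<not> (\<exists>g\<in>A. (e, g) \<in> r)"
      using M_greatest asym irr by (metis irrefl_def)
    then show ?thesis
      using True least_of_eqI[OF tr irr, of "f M" A] M fA fM_least by (simp add: cyclic_succ_def)
  next
    case False
    have next_above: "(f e, g) \<in> r" if g: "g \<in> A" "(e, g) \<in> r" "g \<noteq> f e" for g
    proof (rule ccontr)
      assume "(f e, g) \<notin> r"
      then have gfe: "(g, f e) \<in> r"
        using tot g e fA by (auto simp: total_on_def)
      define B where "B = {x \<in> A. (x, g) \<in> r}"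
      have finB: "finite B" using fin by (simp add: B_def)
      obtain p where p: "p \<in> A" "g = f p"
        using g bij by (auto simp: bij_betw_def)
      \<comment> \<open>\<open>f M\<close> is the least element, but \<open>e\<close> lies below \<open>g = f p\<close>.\<close>
      have "p \<noteq> M"
        using fM_least[OF e] asym g irr p by (metis irrefl_def)
      then have "p \<in> B" "e \<in> B" "p \<noteq> e"
        using asc p g e by (auto simp: B_def)
      then have "card {p, e} = 2" "{p, e} \<subseteq> B" by auto
      then have "card (B - {p, e}) + 2 = card B"
        using finB by (metis card_Diff_subset card_mono finite_subset le_add_diff_inverse2)
      moreover have "card (insert M (B - {p, e})) \<le> card (B - {p, e}) + 1"
        using finB by (simp add: card_insert_if)
      moreover have "{x \<in> A. f x \<in> B} \<subseteq> insert M (B - {p, e})"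
      proof
        fix x assume x: "x \<in> {x \<in> A. f x \<in> B}"
        have "x \<noteq> p" "x \<noteq> e"
          using x p gfe asym irr by (auto simp: B_def irrefl_def)
        moreover have "x \<in> B" if "x \<noteq> M"
          using x asc[OF _ that] tr by (auto simp: B_def dest: transD)
        ultimately show "x \<in> insert M (B - {p, e})" by blast
      qed
      then have "card {x \<in> A. f x \<in> B} \<le> card (insert M (B - {p, e}))"
        using finB by (intro card_mono) auto
      moreover have "f ` {x \<in> A. f x \<in> B} = B"
        using bij by (auto simp: bij_betw_def B_def)
      then have "card {x \<in> A. f x \<in> B} = card B"
        using bij card_image[of f "{x \<in> A. f x \<in> B}"]
        by (metis (no_types, lifting) bij_betw_def inj_on_subset mem_Collect_eq subsetI)
      ultimately show False by linarith
    qed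
    have "(e, f e) \<in> r" "f e \<in> A" using asc False e fA by auto
    then show ?thesis
      using next_above least_of_eqI[OF tr irr, of "f e" "{g \<in> A. (e, g) \<in> r}"]
      by (auto simp: cyclic_succ_def)
  qed
qed

section \<open>Topological sorting of acyclic digraphs\<close>

text \<open>An element with no successor in \<open>A\<close> receives the greatest number; induction numbers the rest.\<close>

lemma acyclic_bijective_numbering:
  assumes "finite A" "acyclic r"
  shows "\<exists>l. bij_betw l A {1..card A} \<and>
    (\<forall>x\<in>A. \<forall>y\<in>A. (x, y) \<in> r \<longrightarrow> l x < (l y :: nat))"
  using assms(1)
proof (induction "card A" arbitrary: A)
  case 0
  then have "A = {}" by simp
  then show ?case by (simp add: bij_betw_def)
next
  case (Suc k)
  have "wf ((r \<inter> A \<times> A)\<inverse>)"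
    by (rule finite_acyclic_wf_converse[OF _ acyclic_subset[OF assms(2)]]) (use Suc.prems in auto)
  moreover obtain a where "a \<in> A" using Suc.hyps(2) by fastforce
  ultimately obtain z where z: "z \<in> A" "\<And>y. (y, z) \<in> (r \<inter> A \<times> A)\<inverse> \<Longrightarrow> y \<notin> A"
    by (rule wfE_min) blast
  have card: "card (A - {z}) = k"
    using Suc.prems Suc.hyps(2)[symmetric] z(1) by simp
  then obtain l where l: "bij_betw l (A - {z}) {1..k}"
    and mono: "\<forall>x\<in>A - {z}. \<forall>y\<in>A - {z}. (x, y) \<in> r \<longrightarrow> l x < (l y :: nat)"
    using Suc.hyps(1)[OF card[symmetric]] Suc.prems by auto
  let ?l = "l(z := Suc k)"
  have "bij_betw ?l (A - {z}) {1..k}"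
    using l by (subst bij_betw_cong[where g = l]) auto
  then have "bij_betw ?l (insert z (A - {z})) (insert (?l z) {1..k})"
    using notIn_Un_bij_betw[of z "A - {z}" ?l "{1..k}"] by simp
  moreover have "insert z (A - {z}) = A" using z(1) by auto
  moreover have "insert (?l z) {1..k} = {1..card A}"
    unfolding Suc.hyps(2)[symmetric] by auto
  moreover have "?l x < ?l y" if "x \<in> A" "y \<in> A" "(x, y) \<in> r" for x y
  proof -
    have "x \<noteq> z" using z that by blast
    moreover from this have "l x \<le> k"
      using bij_betwE[OF l] that(1) by fastforce
    ultimately show ?thesis using mono that by auto
  qed
  ultimately show ?case by metis
qed

lemma is_dag_if_numbering:
  assumes "\<And>a. a \<in> arcs G \<Longrightarrow> l (tail G a) < (l (head G a) :: nat)"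
  shows "is_dag G"
proof -
  have "l u < l v" if "pre_digraph.cas G u p v" "set p \<subseteq> arcs G" "p \<noteq> []" for u p v
    using that
  proof (induction p arbitrary: u)
    case (Cons a p)
    then show ?case
      using assms[of a]
      by (cases "p = []") (auto simp: pre_digraph.cas.simps intro: less_trans)
  qed simp
  then show ?thesis
    by (fastforce simp: is_dag_def pre_digraph.cycle_def pre_digraph.awalk_def)
qed

lemma numbering_if_is_dag:
  assumes fin: "fin_digraph G" and dag: "is_dag G"
  shows "\<exists>l. bij_betw l (verts G) {1..card (verts G)} \<and>
    (\<forall>a\<in>arcs G. l (tail G a) < (l (head G a) :: nat))"
proof -
  interpret fin_digraph G by (fact fin)
  have "acyclic (arcs_ends G)"
  proof (rule acyclicI, intro allI notI)
    fix u assume "u \<rightarrow>\<^sup>+\<^bsub>G\<^esub> u"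
    then obtain p where "awalk u p u" "p \<noteq> []"
      by (auto simp: reachable1_awalk)
    then show False
      using closed_w_imp_cycle[of p] dag by (auto simp: closed_w_def is_dag_def)
  qed
  from acyclic_bijective_numbering[OF finite_verts this] show ?thesis
    by (auto simp: arcs_ends_def arc_to_ends_def)
qed

section \<open>Descents of edge numberings\<close>

definition descents :: "('e \<Rightarrow> nat) \<Rightarrow> ('v, 'e) ceg \<Rightarrow> ('v \<times> 'e) set" where
  "descents l \<Gamma> = {(v, e). v \<in> vertices \<Gamma> \<and> e \<in> edges_at \<Gamma> v \<and> \<not> l e < l (rot \<Gamma> v e)}"

lemma feedback_arc_set_iff_contains_descents:
  assumes "is_ceg \<Gamma>"
  shows "feedback_arc_set (medial_digraph \<Gamma>) F \<longleftrightarrow> F \<subseteq> arcs (medial_digraph \<Gamma>) \<and>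
    (\<exists>l. bij_betw l (edges \<Gamma>) {1..card (edges \<Gamma>)} \<and> descents l \<Gamma> \<subseteq> F)"
proof -
  let ?D = "medial_digraph \<Gamma>"
  let ?H = "?D\<lparr>arcs := arcs ?D - F\<rparr>"
  interpret D: fin_digraph ?D
    using assms by (rule fin_digraph_medial_digraph)
  have "fin_digraph ?H"
    by unfold_locales auto
  then have "is_dag ?H \<longleftrightarrow> (\<exists>l. bij_betw l (verts ?H) {1..card (verts ?H)} \<and>
      (\<forall>a\<in>arcs ?H. l (tail ?H a) < (l (head ?H a) :: nat)))"
    using numbering_if_is_dag[of ?H] is_dag_if_numbering[of ?H] by blast
  moreover have "verts ?H = edges \<Gamma>"
    by (simp add: medial_digraph_def)
  moreover have "(\<forall>a\<in>arcs ?H. l (tail ?H a) < l (head ?H a)) \<longleftrightarrow> descents l \<Gamma> \<subseteq> F"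
    for l :: "'b \<Rightarrow> nat"
    by (auto simp: medial_digraph_def descents_def Ball_def)
  ultimately show ?thesis
    unfolding feedback_arc_set_def by metis
qed

text \<open>At an edge with the greatest number among those at a vertex the numbering cannot increase.\<close>

lemma descents_meet_every_vertex:
  assumes ceg: "is_ceg \<Gamma>" and "no_isolated_vertices \<Gamma>"
  shows "fst ` descents l \<Gamma> = vertices \<Gamma>"
proof
  show "vertices \<Gamma> \<subseteq> fst ` descents l \<Gamma>"
  proof
    fix v assume v: "v \<in> vertices \<Gamma>"
    then have ne: "edges_at \<Gamma> v \<noteq> {}" and cyc: "cyclic_on (rot \<Gamma> v) (edges_at \<Gamma> v)"
      using assms by (auto simp: no_isolated_vertices_def is_ceg_def)
    have fin: "finite (l ` edges_at \<Gamma> v)"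
      using cyc by (simp add: finite_cyclic_on)
    obtain e where e: "e \<in> edges_at \<Gamma> v" "l e = Max (l ` edges_at \<Gamma> v)"
      using Max_in[OF fin] ne by fastforce
    have "l (rot \<Gamma> v e) \<le> l e"
      using cyclic_on_inI[OF cyc e(1)] fin by (simp add: e(2))
    then have "(v, e) \<in> descents l \<Gamma>"
      using v e by (simp add: descents_def)
    then show "v \<in> fst ` descents l \<Gamma>" by force
  qed
qed (auto simp: descents_def)

lemma finite_descents:
  assumes "is_ceg \<Gamma>"
  shows "finite (descents l \<Gamma>)"
proof (rule finite_subset)
  show "descents l \<Gamma> \<subseteq> vertices \<Gamma> \<times> edges \<Gamma>"
    by (auto simp: descents_def edges_at_def)
qed (use assms in \<open>simp add: is_ceg_def is_mgraph_def\<close>)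

lemma card_descents_eq_iff_inj_on:
  assumes "is_ceg \<Gamma>" "no_isolated_vertices \<Gamma>"
  shows "card (descents l \<Gamma>) = card (vertices \<Gamma>) \<longleftrightarrow> inj_on fst (descents l \<Gamma>)"
  using descents_meet_every_vertex[OF assms, of l] finite_descents[OF assms(1), of l]
  by (metis card_image eq_card_imp_inj_on)

section \<open>Numberings coming from a factorization\<close>

lemma strict_linear_order_on_label:
  assumes "is_egraph m \<Delta>" "v \<in> vertices \<Delta>"
  shows "strict_linear_order_on (edges_at \<Delta> v) (lin (peg_of_egraph \<Delta>) v)"
proof -
  have eq: "edges_at \<Delta> v = edges_at (peg_of_egraph \<Delta>) v"
    and "vertices (peg_of_egraph \<Delta>) = vertices \<Delta>"
    by (simp_all add: edges_at_def peg_of_egraph_def)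
  then show ?thesis
    unfolding eq using is_peg_peg_of_egraph[OF assms(1)] assms(2) by (simp add: is_peg_def)
qed

lemma rot_closure_egraph:
  "rot (peg_closure (peg_of_egraph \<Delta>)) v =
    cyclic_succ (edges_at \<Delta> v) (lin (peg_of_egraph \<Delta>) v)"
  by (simp add: peg_closure_def edges_at_def peg_of_egraph_def)

text \<open>
  Pulling the labels of an e-graph back along the isomorphism gives a numbering whose descents at
  a vertex are the edges without a larger label there, and labels are distinct.
\<close>

lemma single_descents_if_comes_from_factorization:
  assumes "comes_from_factorization \<Gamma>"
  shows "\<exists>l. bij_betw l (edges \<Gamma>) {1..card (edges \<Gamma>)} \<and> inj_on fst (descents l \<Gamma>)"
proof -
  obtain m and \<Delta> :: "('a, 'b) egraph" where \<Delta>: "is_egraph m \<Delta>"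
    and iso: "ceg_iso \<Gamma> (peg_closure (peg_of_egraph \<Delta>))"
    using assms by (auto simp: comes_from_factorization_def)
  have [simp]: "vertices (peg_closure (peg_of_egraph \<Delta>)) = vertices \<Delta>"
    "edges (peg_closure (peg_of_egraph \<Delta>)) = edges \<Delta>"
    "ends (peg_closure (peg_of_egraph \<Delta>)) = ends \<Delta>"
    by (simp_all add: peg_closure_def peg_of_egraph_def)
  obtain \<phi> \<psi> where \<phi>: "bij_betw \<phi> (vertices \<Gamma>) (vertices \<Delta>)"
    and \<psi>: "bij_betw \<psi> (edges \<Gamma>) (edges \<Delta>)"
    and ends: "\<And>e. e \<in> edges \<Gamma> \<Longrightarrow> ends \<Delta> (\<psi> e) = \<phi> ` ends \<Gamma> e"
    and rot: "\<And>v e. v \<in> vertices \<Gamma> \<Longrightarrow> e \<in> edges_at \<Gamma> v \<Longrightarrow>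
      cyclic_succ (edges_at \<Delta> (\<phi> v)) (lin (peg_of_egraph \<Delta>) (\<phi> v)) (\<psi> e) = \<psi> (rot \<Gamma> v e)"
    using iso by (auto simp: ceg_iso_def rot_closure_egraph)
  let ?l = "label \<Delta> \<circ> \<psi>"
  have "bij_betw ?l (edges \<Gamma>) {1..m}"
    using \<Delta> \<psi> bij_betw_trans by (auto simp: is_egraph_def)
  moreover from this have "m = card (edges \<Gamma>)"
    using bij_betw_same_card by fastforce
  moreover have "e = f" if de: "(v, e) \<in> descents ?l \<Gamma>" and df: "(v, f) \<in> descents ?l \<Gamma>" for v e f
  proof -
    let ?A = "edges_at \<Delta> (\<phi> v)" and ?r = "lin (peg_of_egraph \<Delta>) (\<phi> v)"
    have v: "v \<in> vertices \<Gamma>"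
      using de by (simp add: descents_def)
    then have \<phi>v: "\<phi> v \<in> vertices \<Delta>"
      using \<phi> by (auto simp: bij_betw_def)
    have lin: "strict_linear_order_on ?A ?r"
      using strict_linear_order_on_label[OF \<Delta> \<phi>v] .
    have fin: "finite ?A"
      using \<Delta> by (simp add: is_egraph_def is_mgraph_def edges_at_def)
    have maximal: "\<psi> x \<in> ?A \<and> (\<forall>y\<in>?A. (\<psi> x, y) \<notin> ?r)" if x: "(v, x) \<in> descents ?l \<Gamma>" for x
    proof
      have xv: "x \<in> edges_at \<Gamma> v" and desc: "\<not> ?l x < ?l (rot \<Gamma> v x)"
        using x by (auto simp: descents_def)
      show \<psi>x: "\<psi> x \<in> ?A"
        using xv \<psi> ends by (auto simp: edges_at_def bij_betw_def)
      have "(\<psi> x, \<psi> (rot \<Gamma> v x)) \<notin> ?r"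
        using desc by (simp add: peg_of_egraph_def)
      then show "\<forall>y\<in>?A. (\<psi> x, y) \<notin> ?r"
        using cyclic_succ_ascends_iff[OF lin fin \<psi>x] rot[OF v xv] by simp
    qed
    have "\<psi> e = \<psi> f"
      using maximal[OF de] maximal[OF df] lin
      by (auto simp: strict_linear_order_on_def total_on_def)
    then show ?thesis
      using \<psi> de df by (auto simp: descents_def edges_at_def bij_betw_def dest: inj_onD)
  qed
  then have "inj_on fst (descents ?l \<Gamma>)"
    by (auto simp: inj_on_def)
  ultimately show ?thesis by blast
qed

text \<open>A numbering with one descent per vertex labels \<open>\<Gamma>\<close> itself, and the identity is the isomorphism.\<close>

lemma comes_from_factorization_if_single_descents:
  assumes ceg: "is_ceg \<Gamma>" and iso: "no_isolated_vertices \<Gamma>"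
    and l: "bij_betw l (edges \<Gamma>) {1..m}" and inj: "inj_on fst (descents l \<Gamma>)"
  shows "comes_from_factorization \<Gamma>"
proof -
  define \<Delta> :: "('a, 'b) egraph" where
    "\<Delta> = \<lparr>vertices = vertices \<Gamma>, edges = edges \<Gamma>, ends = ends \<Gamma>, label = l\<rparr>"
  have [simp]: "edges_at \<Delta> v = edges_at \<Gamma> v" for v
    by (simp add: edges_at_def \<Delta>_def)
  have \<Delta>: "is_egraph m \<Delta>"
    using ceg l by (simp add: is_egraph_def \<Delta>_def is_ceg_def is_mgraph_def)
  have "rot (peg_closure (peg_of_egraph \<Delta>)) v e = rot \<Gamma> v e"
    if v: "v \<in> vertices \<Gamma>" and e: "e \<in> edges_at \<Gamma> v" for v e
  proof -
    have cyc: "cyclic_on (rot \<Gamma> v) (edges_at \<Gamma> v)"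
      using ceg v e by (auto simp: is_ceg_def)
    obtain M where M: "(v, M) \<in> descents l \<Gamma>"
      using descents_meet_every_vertex[OF ceg iso, of l] v by force
    have asc: "(x, rot \<Gamma> v x) \<in> lin (peg_of_egraph \<Delta>) v" if x: "x \<in> edges_at \<Gamma> v" "x \<noteq> M" for x
    proof -
      have "(v, x) \<notin> descents l \<Gamma>"
        using inj_onD[OF inj, of "(v, x)" "(v, M)"] M x by auto
      then have "l x < l (rot \<Gamma> v x)"
        using v x by (simp add: descents_def)
      moreover have "rot \<Gamma> v x \<in> edges_at \<Gamma> v"
        using cyc x by (auto intro: cyclic_on_inI)
      ultimately show ?thesis
        using x by (simp add: peg_of_egraph_def) (simp add: \<Delta>_def)
    qed
    have "strict_linear_order_on (edges_at \<Gamma> v) (lin (peg_of_egraph \<Delta>) v)"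
      using strict_linear_order_on_label[OF \<Delta>, of v] v by (simp add: \<Delta>_def edges_at_def)
    moreover have "M \<in> edges_at \<Gamma> v"
      using M by (simp add: descents_def)
    ultimately show ?thesis
      using cyclic_succ_eq_if_single_descent[OF _ cyc _ asc e] by (simp add: rot_closure_egraph)
  qed
  moreover have "vertices (peg_closure (peg_of_egraph \<Delta>)) = vertices \<Gamma>"
    "edges (peg_closure (peg_of_egraph \<Delta>)) = edges \<Gamma>"
    "ends (peg_closure (peg_of_egraph \<Delta>)) = ends \<Gamma>"
    by (simp_all add: peg_closure_def peg_of_egraph_def \<Delta>_def)
  ultimately have "ceg_iso \<Gamma> (peg_closure (peg_of_egraph \<Delta>))"
    unfolding ceg_iso_def by (intro exI[of _ id]) simp
  then show ?thesis
    using \<Delta> unfolding comes_from_factorization_def by blast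
qed

lemma comes_from_factorization_iff_descents:
  assumes "is_ceg \<Gamma>" "no_isolated_vertices \<Gamma>"
  shows "comes_from_factorization \<Gamma> \<longleftrightarrow> (\<exists>l. bij_betw l (edges \<Gamma>) {1..card (edges \<Gamma>)} \<and>
    card (descents l \<Gamma>) = card (vertices \<Gamma>))"
  unfolding card_descents_eq_iff_inj_on[OF assms]
  using single_descents_if_comes_from_factorization
    comes_from_factorization_if_single_descents[OF assms] by blast

section \<open>Factorizations and feedback arc sets\<close>

theorem proposition4p12:
  fixes \<Gamma> :: "('v, 'e) ceg" and n :: nat
  assumes "is_ceg \<Gamma>"
    and "card (vertices \<Gamma>) = n"
    and "no_isolated_vertices \<Gamma>"
  shows "comes_from_factorization \<Gamma> \<longleftrightarrow>
    (\<exists>F. feedback_arc_set (medial_digraph \<Gamma>) F \<and> card F = n)"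
proof
  assume "comes_from_factorization \<Gamma>"
  then obtain l where "bij_betw l (edges \<Gamma>) {1..card (edges \<Gamma>)}" "card (descents l \<Gamma>) = n"
    using assms by (auto simp: comes_from_factorization_iff_descents)
  moreover have "descents l \<Gamma> \<subseteq> arcs (medial_digraph \<Gamma>)"
    by (auto simp: descents_def medial_digraph_def)
  ultimately show "\<exists>F. feedback_arc_set (medial_digraph \<Gamma>) F \<and> card F = n"
    using feedback_arc_set_iff_contains_descents[OF assms(1)] by blast
next
  assume "\<exists>F. feedback_arc_set (medial_digraph \<Gamma>) F \<and> card F = n"
  then obtain F l where F: "F \<subseteq> arcs (medial_digraph \<Gamma>)" "card F = n"
    and l: "bij_betw l (edges \<Gamma>) {1..card (edges \<Gamma>)}" and "descents l \<Gamma> \<subseteq> F"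
    unfolding feedback_arc_set_iff_contains_descents[OF assms(1)] by blast
  moreover have "finite F"
    using F fin_digraph.finite_arcs[OF fin_digraph_medial_digraph[OF assms(1)]]
    by (auto intro: finite_subset)
  ultimately have "card (descents l \<Gamma>) \<le> n"
    by (auto intro: card_mono)
  moreover have "n \<le> card (descents l \<Gamma>)"
    using card_image_le[OF finite_descents[OF assms(1)], of fst l]
      descents_meet_every_vertex[OF assms(1,3), of l] assms(2) by simp
  ultimately show "comes_from_factorization \<Gamma>"
    using l assms by (auto simp: comes_from_factorization_iff_descents)
qed

end
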